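(* Every rigidity sequence $(n_k)_{k\ge 0}$ is nullpotent, i.e. there exists a Hausdorff group topology $\tau$ on $\mathbb{Z}$ such that $n_k\to 0$ with respect to $\tau$ as $k\to\infty$.
   Context: $\mathbb{T}=\{z\in\mathbb{C}: |z|=1\}$. $\mathcal{P}_c(\mathbb{T})$ is the set of Borel probability measures $\mu$ on $\mathbb{T}$ with $\mu(\{z\})=0$ for every $z\in\mathbb{T}$. For $n\in\mathbb{Z}$, $\widehat{\mu}(n)=\int_{\mathbb{T}} z^n\,d\mu(z)$. Rigidity sequence: a sequence of integers $(n_k)_{k\ge 0}$ is a rigidity sequence if there exists $\mu\in\mathcal{P}_c(\mathbb{T})$ such that $\widehat{\mu}(n_k)\to 1$ as $k\to\infty$. (For sequences of positive integers this is known to be equivalent to the existence of a weakly mixing measure-preserving system $(X,\mathcal{B},m;T)$ on a probability space such that $m(T^{-n_k}A\,\Delta\,A)\to 0$ for every $A\in\mathcal{B}$.) A Hausdorff group topology on $\mathbb{Z}$ is a Hausdorff topology turning the additive group $\mathbb{Z}$ into a topological group. *)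

theory Defs
  imports "HOL-Probability.Probability"
begin

definition unit_circle :: "complex set" where
  "unit_circle = {z. cmod z = 1}"

(* The measure lives on the circle itself: its space is unit_circle, not the whole complex plane. *)
definition continuous_prob_measures :: "complex measure set" where
  "continuous_prob_measures =
     {\<mu>. prob_space \<mu> \<and> sets \<mu> = sets (restrict_space borel unit_circle) \<and>
         (\<forall>z\<in>unit_circle. measure \<mu> {z} = 0)}"

(* The exponent is +n, not -n. *)
definition fourier_coeff :: "complex measure \<Rightarrow> int \<Rightarrow> complex" where
  "fourier_coeff \<mu> n = (LINT z|\<mu>. z powi n)"

definition rigidity_sequence :: "(nat \<Rightarrow> int) \<Rightarrow> bool" where
  "rigidity_sequence n \<longleftrightarrow>
     (\<exists>\<mu>\<in>continuous_prob_measures. (\<lambda>k. fourier_coeff \<mu> (n k)) \<longlonglongrightarrow> 1)"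

(* An explicit topology is used since the type-class topology on int is fixed (discrete). *)
definition hausdorff_group_topology :: "int topology \<Rightarrow> bool" where
  "hausdorff_group_topology \<tau> \<longleftrightarrow>
     topspace \<tau> = UNIV \<and> Hausdorff_space \<tau> \<and>
     continuous_map (prod_topology \<tau> \<tau>) \<tau> (\<lambda>(x, y). x + y) \<and>
     continuous_map \<tau> \<tau> (\<lambda>x. - x)"

definition nullpotent :: "(nat \<Rightarrow> int) \<Rightarrow> bool" where
  "nullpotent n \<longleftrightarrow> (\<exists>\<tau>. hausdorff_group_topology \<tau> \<and> limitin \<tau> n 0 sequentially)"

end

theory Submission
  imports Defs
begin

text \<open>
  Let \<open>\<mu>\<close> be a continuous probability measure on the circle. Then
  \<open>N m = \<integral> \<bar>z\<^sup>m - 1\<bar> d\<mu>(z)\<close> is a group norm on the integers: it is nondegenerate because, for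
  \<open>m \<noteq> 0\<close>, the equation \<open>z\<^sup>m = 1\<close> has finitely many solutions, a null set for \<open>\<mu>\<close>. By
  Jensen's inequality \<open>(N m)\<^sup>2 \<le> \<integral> \<bar>z\<^sup>m - 1\<bar>\<^sup>2 d\<mu>(z)\<close>, which is \<open>2\<close> minus twice the real part of
  the \<open>m\<close>-th Fourier coefficient. Hence \<open>N (n k) \<rightarrow> 0\<close> whenever the coefficients at \<open>n k\<close> tend
  to \<open>1\<close>, and the metric \<open>N (x - y)\<close> induces the topology.
\<close>

text \<open>Symmetry and subadditivity make \<open>N (x - y)\<close> a translation-invariant metric
  for which negation is an isometry and addition is Lipschitz; metric topologies are
  Hausdorff.\<close>

lemma nullpotent_if_group_norm_tendsto_0:
  fixes N :: "int \<Rightarrow> real"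
  assumes N_zero: "\<And>m. N m = 0 \<longleftrightarrow> m = 0"
    and N_minus: "\<And>m. N (- m) = N m"
    and N_triangle: "\<And>a b. N (a + b) \<le> N a + N b"
    and lim: "(\<lambda>k. N (n k)) \<longlonglongrightarrow> 0"
  shows "nullpotent n"
proof -
  define d where "d = (\<lambda>x y. N (x - y))"
  \<comment> \<open>Nonnegativity follows from
    \<open>0 = N (m + (- m)) \<le> N m + N (- m) = 2 * N m\<close>.\<close>
  have N_nonneg: "N m \<ge> 0" for m
    using N_triangle[of m "- m"] N_minus[of m] N_zero[of 0] by simp
  interpret Metric_space UNIV d
  proof
    show "d x y = d y x" for x y
      using N_minus[of "x - y"] by (simp add: d_def)
    show "d x z \<le> d x y + d y z" for x y z
      using N_triangle[of "x - y" "y - z"] by (simp add: d_def)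
  qed (simp_all add: d_def N_nonneg N_zero)
  have add: "continuous_map (prod_topology mtopology mtopology) mtopology (\<lambda>(x, y). x + y)"
    unfolding continuous_map_to_metric
  proof (intro ballI allI impI)
    fix p :: "int \<times> int" and e :: real
    assume "e > 0"
    obtain x y where p: "p = (x, y)" by (cases p)
    have "d (x + y) (u + v) < e" if "d x u < e / 2" "d y v < e / 2" for u v
    proof -
      have "d (x + y) (u + v) \<le> d x u + d y v"
        using N_triangle[of "x - u" "y - v"] by (simp add: d_def add_diff_add)
      with that show ?thesis by simp
    qed
    then show "\<exists>U. openin (prod_topology mtopology mtopology) U \<and> p \<in> U \<and>
        (\<forall>q\<in>U. (case q of (x, y) \<Rightarrow> x + y) \<in> mball (case p of (x, y) \<Rightarrow> x + y) e)"
      using \<open>e > 0\<close> p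
      by (intro exI[of _ "mball x (e / 2) \<times> mball y (e / 2)"])
         (auto simp: openin_prod_Times_iff)
  qed
  have neg: "continuous_map mtopology mtopology (\<lambda>x. - x)"
    unfolding continuous_map_to_metric
  proof (intro ballI allI impI)
    fix x :: int and e :: real
    assume "e > 0"
    have "d (- x) (- y) = d x y" for y
      using N_minus[of "x - y"] by (simp add: d_def)
    then show "\<exists>U. openin mtopology U \<and> x \<in> U \<and> (\<forall>y\<in>U. - y \<in> mball (- x) e)"
      using \<open>e > 0\<close> by (intro exI[of _ "mball x e"]) auto
  qed
  have "limitin mtopology n 0 sequentially"
    unfolding limitin_metric
    using order_tendstoD(2)[OF lim] by (simp add: d_def)
  with add neg show ?thesis
    unfolding nullpotent_def hausdorff_group_topology_def
    using Hausdorff_space_mtopology by (intro exI[of _ mtopology]) auto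
qed

text \<open>An inverse equals 1 only if the number itself does, so for either sign of
  \<open>m\<close> every solution is a root of unity of order dividing
  \<open>\<bar>m\<bar>\<close>.\<close>

lemma finite_powi_eq_1:
  fixes m :: int
  assumes "m \<noteq> 0"
  shows "finite {z :: complex. z powi m = 1}"
proof -
  have "{z :: complex. z powi m = 1} \<subseteq> {z. z ^ nat \<bar>m\<bar> = 1}"
    by (auto simp: power_int_def power_inverse abs_if split: if_splits)
  moreover have "finite {z :: complex. z ^ nat \<bar>m\<bar> = 1}"
    using assms by (intro finite_roots_unity) auto
  ultimately show ?thesis
    by (rule finite_subset)
qed

text \<open>Applied to \<open>w = z powi m\<close> and integrated, this turns a mean square distance
  to 1 into a Fourier coefficient.\<close>

lemma norm_diff_1_power2_eq:
  fixes w :: complex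
  assumes "cmod w = 1"
  shows "(cmod (w - 1))\<^sup>2 = 2 - 2 * Re w"
proof -
  have "(Re w)\<^sup>2 + (Im w)\<^sup>2 = 1"
    using cmod_power2[of w] assms by simp
  then show ?thesis
    unfolding cmod_power2 by (simp add: power2_eq_square algebra_simps)
qed

context
  fixes \<mu> :: "complex measure"
  assumes \<mu>: "\<mu> \<in> continuous_prob_measures"
begin

interpretation prob_space \<mu>
  using \<mu> by (simp add: continuous_prob_measures_def)

lemma sets_continuous_prob_measure: "sets \<mu> = sets (restrict_space borel unit_circle)"
  using \<mu> by (simp add: continuous_prob_measures_def)

lemma space_continuous_prob_measure: "space \<mu> = unit_circle"
  using sets_eq_imp_space_eq[OF sets_continuous_prob_measure] by (simp add: space_restrict_space)

lemma norm_powi_eq_1: "z \<in> space \<mu> \<Longrightarrow> cmod (z powi m) = 1"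
  by (simp add: space_continuous_prob_measure unit_circle_def norm_power_int)

lemma measurable_powi [measurable]: "(\<lambda>z. z powi m) \<in> borel_measurable \<mu>"
proof -
  \<comment> \<open>The inclusion of the circle into the plane is Borel measurable for the trace
    sigma-algebra carried by \<open>\<mu>\<close>.\<close>
  have [measurable]: "(\<lambda>z. z) \<in> borel_measurable \<mu>"
    using measurable_cong_sets[OF sets_continuous_prob_measure refl]
      measurable_restrict_space1[OF measurable_ident] by (auto simp: id_def)
  show ?thesis
    unfolding power_int_def by measurable
qed

lemma integrable_powi: "integrable \<mu> (\<lambda>z. z powi m)"
  by (rule integrable_const_bound[of _ 1]) (simp_all add: norm_powi_eq_1)

lemma integrable_norm_powi_diff_1: "integrable \<mu> (\<lambda>z. cmod (z powi m - 1))"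
  by (intro integrable_norm Bochner_Integration.integrable_diff integrable_powi) simp

lemma integral_norm_powi_diff_1_eq_0_iff:
  "(LINT z|\<mu>. cmod (z powi m - 1)) = 0 \<longleftrightarrow> m = 0"
proof
  assume 0: "(LINT z|\<mu>. cmod (z powi m - 1)) = 0"
  show "m = 0"
  proof (rule ccontr)
    assume "m \<noteq> 0"
    \<comment> \<open>Absence of atoms: almost every point avoids a given \<open>w\<close>, hence
      also any given finite subset of the circle.\<close>
    have "AE z in \<mu>. z \<noteq> w" if "w \<in> unit_circle" for w
    proof (rule AE_I')
      have "{w} \<in> sets \<mu>"
        using that by (auto simp: sets_continuous_prob_measure sets_restrict_space_iff
            unit_circle_def)
      moreover have "measure \<mu> {w} = 0"
        using \<mu> that by (simp add: continuous_prob_measures_def)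
      ultimately show "{w} \<in> null_sets \<mu>"
        by (simp add: null_sets_def emeasure_eq_measure)
    qed auto
    then have "AE z in \<mu>. \<forall>w\<in>{z. z powi m = 1} \<inter> unit_circle. z \<noteq> w"
      using finite_powi_eq_1[OF \<open>m \<noteq> 0\<close>] by (intro AE_finite_allI) auto
    moreover have "AE z in \<mu>. z powi m = 1"
      using 0 integral_nonneg_eq_0_iff_AE[OF integrable_norm_powi_diff_1[of m]] by simp
    \<comment> \<open>Almost every point would both solve the equation and avoid all its solutions
      on the circle, which total mass 1 forbids.\<close>
    ultimately have "AE z in \<mu>. False"
      using AE_space by eventually_elim (auto simp: space_continuous_prob_measure)
    then show False
      by simp
  qed
qed simp

text \<open>The integrands already agree on the circle, since the two differences differ only by a
  unimodular factor.\<close>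

lemma integral_norm_powi_diff_1_minus:
  "(LINT z|\<mu>. cmod (z powi (- m) - 1)) = (LINT z|\<mu>. cmod (z powi m - 1))"
proof (rule Bochner_Integration.integral_cong)
  fix z assume z: "z \<in> space \<mu>"
  then have "z \<noteq> 0"
    by (auto simp: space_continuous_prob_measure unit_circle_def)
  then have "z powi (- m) - 1 = - (z powi (- m) * (z powi m - 1))"
    by (simp add: power_int_minus field_simps)
  then show "cmod (z powi (- m) - 1) = cmod (z powi m - 1)"
    by (simp add: norm_mult norm_powi_eq_1[OF z] del: minus_diff_eq)
qed simp

lemma integral_norm_powi_diff_1_triangle:
  "(LINT z|\<mu>. cmod (z powi (a + b) - 1)) \<le>
    (LINT z|\<mu>. cmod (z powi a - 1)) + (LINT z|\<mu>. cmod (z powi b - 1))"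
proof -
  have "cmod (z powi (a + b) - 1) \<le> cmod (z powi a - 1) + cmod (z powi b - 1)"
    if z: "z \<in> space \<mu>" for z
  proof -
    have "z \<noteq> 0"
      using z by (auto simp: space_continuous_prob_measure unit_circle_def)
    \<comment> \<open>Passing from 1 to \<open>z powi (a + b)\<close> through
      \<open>z powi a\<close> leaves a unimodular factor that the norm removes.\<close>
    then have "z powi (a + b) - 1 = (z powi a - 1) + z powi a * (z powi b - 1)"
      by (simp add: power_int_add algebra_simps)
    then have "cmod (z powi (a + b) - 1) \<le>
        cmod (z powi a - 1) + cmod (z powi a * (z powi b - 1))"
      by (metis norm_triangle_ineq)
    then show ?thesis
      by (simp add: norm_mult norm_powi_eq_1[OF z])
  qed
  then have "(LINT z|\<mu>. cmod (z powi (a + b) - 1)) \<le>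
      (LINT z|\<mu>. cmod (z powi a - 1) + cmod (z powi b - 1))"
    by (intro integral_mono Bochner_Integration.integrable_add integrable_norm_powi_diff_1)
  then show ?thesis
    by (simp add: integrable_norm_powi_diff_1)
qed

lemma integral_norm_powi_diff_1_power2_le:
  "(LINT z|\<mu>. cmod (z powi m - 1))\<^sup>2 \<le> 2 - 2 * Re (fourier_coeff \<mu> m)"
proof -
  have eq: "(cmod (z powi m - 1))\<^sup>2 = 2 - 2 * Re (z powi m)" if "z \<in> space \<mu>" for z
    using that by (intro norm_diff_1_power2_eq norm_powi_eq_1)
  have int: "integrable \<mu> (\<lambda>z. 2 - 2 * Re (z powi m))"
    by (intro Bochner_Integration.integrable_diff integrable_mult_right integrable_Re
        integrable_powi) simp
  then have int2: "integrable \<mu> (\<lambda>z. (cmod (z powi m - 1))\<^sup>2)"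
    by (subst Bochner_Integration.integrable_cong[OF refl eq])
  \<comment> \<open>Jensen's inequality for the square, in the form that a variance is
    nonnegative.\<close>
  have "(LINT z|\<mu>. cmod (z powi m - 1))\<^sup>2 \<le> (LINT z|\<mu>. (cmod (z powi m - 1))\<^sup>2)"
    using variance_eq[OF integrable_norm_powi_diff_1 int2]
      variance_positive[of "\<lambda>z. cmod (z powi m - 1)"] by simp
  also have "\<dots> = (LINT z|\<mu>. 2 - 2 * Re (z powi m))"
    by (intro Bochner_Integration.integral_cong refl eq)
  also have "\<dots> = 2 - 2 * Re (fourier_coeff \<mu> m)"
    using integrable_powi[of m] by (simp add: fourier_coeff_def prob_space)
  finally show ?thesis .
qed

end

theorem corollary3p6:
  fixes n :: "nat \<Rightarrow> int"
  assumes "rigidity_sequence n"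
  shows "nullpotent n"
proof -
  obtain \<mu> where \<mu>: "\<mu> \<in> continuous_prob_measures"
    and lim: "(\<lambda>k. fourier_coeff \<mu> (n k)) \<longlonglongrightarrow> 1"
    using assms by (auto simp: rigidity_sequence_def)
  define N where "N = (\<lambda>m :: int. LINT z|\<mu>. cmod (z powi m - 1))"
  \<comment> \<open>This square root dominates \<open>N (n k)\<close>, and its limit is
    \<open>sqrt 0\<close>, so \<open>N (n k)\<close> is squeezed to 0.\<close>
  have "(\<lambda>k. sqrt (2 - 2 * Re (fourier_coeff \<mu> (n k)))) \<longlonglongrightarrow> sqrt (2 - 2 * Re 1)"
    by (intro tendsto_intros lim)
  then have sqrt_lim: "(\<lambda>k. sqrt (2 - 2 * Re (fourier_coeff \<mu> (n k)))) \<longlonglongrightarrow> 0"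
    by simp
  have "N m \<le> sqrt (2 - 2 * Re (fourier_coeff \<mu> m))" for m
    unfolding N_def by (intro real_le_rsqrt integral_norm_powi_diff_1_power2_le[OF \<mu>])
  moreover have "0 \<le> N m" for m
    by (simp add: N_def)
  ultimately have "\<forall>\<^sub>F k in sequentially. norm (N (n k)) \<le> sqrt (2 - 2 * Re (fourier_coeff \<mu> (n k)))"
    by (intro always_eventually) simp
  then have "(\<lambda>k. N (n k)) \<longlonglongrightarrow> 0"
    using sqrt_lim by (rule Lim_null_comparison)
  then show ?thesis
    using integral_norm_powi_diff_1_eq_0_iff[OF \<mu>] integral_norm_powi_diff_1_minus[OF \<mu>]
      integral_norm_powi_diff_1_triangle[OF \<mu>]
    unfolding N_def by (rule nullpotent_if_group_norm_tendsto_0[rotated 3])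
qed

end
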